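(* Let $\mathcal{M}$ be a class of individually rational contextual auction mechanisms with $n$ bidders and $m$ items, and assume that for each bidder $i\in N$ and each $v_i\in\mathcal{V}_i$ the additive valuation function $v_i(S)=\sum_{j\in S}v_{ij}$ satisfies $v_i(S)\le 1$ for all $S\subseteq M$. Fix $\delta,\epsilon\in(0,1)$. For any $(g^w,p^w)\in\mathcal{M}$, when $$L \ge \frac{9n^2}{2\epsilon^2}\left(\ln\frac{4}{\delta}+\ln \mathcal{N}_{\infty,1}\Big(\mathcal{M},\frac{\epsilon}{6n}\Big)\right),$$ with probability at least $1-\delta$ over the draw of a training set $S=\{(v^{(\ell)},x^{(\ell)},y^{(\ell)})\}_{\ell=1}^L$ of $L$ independent samples from $\mathcal{D}_{v,x,y}$, we have both $$\left|\sum_{i=1}^n\Big(\mathbb{E}_{(v,x,y)\sim\mathcal{D}_{v,x,y}}\,[p^w_i(v,x,y)]-\frac1L\sum_{\ell=1}^L p^w_i(v^{(\ell)},x^{(\ell)},y^{(\ell)})\Big)\right|\le\epsilon$$ and $$\left|\mathbb{E}_{(v,x,y)\sim\mathcal{D}_{v,x,y}}\Big[\sum_{i=1}^n rgt_i^w(v,x,y)\Big]-\sum_{i=1}^n\widehat{rgt}_i(w)\right|\le\epsilon .$$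
   Context: Setting. $N=\{1,\dots,n\}$ is the set of bidders and $M=\{1,\dots,m\}$ the set of items. Bidder contexts $x=(x_1,\dots,x_n)\in\mathcal{X}^n$ with $\mathcal{X}\subset\mathbb{R}^{d_x}$; item contexts $y=(y_1,\dots,y_m)\in\mathcal{Y}^m$ with $\mathcal{Y}\subset\mathbb{R}^{d_y}$. Bidder $i$ has valuation profile $v_i=(v_{i1},\dots,v_{im})\in\mathcal{V}_i\subset\mathbb{R}^m$, and $\mathcal{V}=\mathcal{V}_1\times\dots\times\mathcal{V}_n$. Valuations are additive: bidder $i$ values $S\subseteq M$ at $v_i(S)=\sum_{j\in S}v_{ij}$. $\mathcal{D}_{v,x,y}$ is a joint probability distribution of $(v,x,y)$ on $\mathcal{V}\times\mathcal{X}^n\times\mathcal{Y}^m$. Bids $b=(b_1,\dots,b_n)$ lie in $\mathcal{V}$; $v_{-i}$, $b_{-i}$ denote profiles with bidder $i$ removed. Contextual auction mechanism $(g,p)$: an allocation rule $g=(g_{ij})_{i\in N,j\in M}$ with $g_{ij}(b,x,y)\in[0,1]$ and $\sum_{i=1}^n g_{ij}(b,x,y)\le 1$ for every $j$ and every $(b,x,y)$, and a payment rule $p=(p_1,\dots,p_n)$ with $p_i(b,x,y)\in\mathbb{R}_{\ge0}$. Utility: $u_i(v_i,b,x,y)=\sum_{j=1}^m g_{ij}(b,x,y)v_{ij}-p_i(b,x,y)$. Individually rational (IR): $u_i(v_i,(v_i,b_{-i}),x,y)\ge0$ for all $i$, $v_i\in\mathcal{V}_i$, $b_{-i}\in\mathcal{V}_{-i}$,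 $x\in\mathcal{X}^n$, $y\in\mathcal{Y}^m$. Ex-post regret: $rgt_i(v,x,y)=\max_{b_i\in\mathcal{V}_i}u_i(v_i,(b_i,v_{-i}),x,y)-u_i(v_i,v,x,y)$ (read $\max$ as supremum if not attained). The superscript $w$ denotes the quantity for the (parameterized) mechanism $(g^w,p^w)$; the empirical regret is $\widehat{rgt}_i(w)=\frac1L\sum_{\ell=1}^L rgt_i^w(v^{(\ell)},x^{(\ell)},y^{(\ell)})$. The functions involved are taken to be measurable, so that expectations make sense. Covering number: the $\ell_{\infty,1}$-distance between $(g,p),(g',p')\in\mathcal{M}$ is $\max_{v,x,y}\big(\sum_{i\in N,j\in M}|g_{ij}(v,x,y)-g'_{ij}(v,x,y)|+\sum_{i\in N}|p_i(v,x,y)-p'_i(v,x,y)|\big)$ (maximum/supremum over $\mathcal{V}\times\mathcal{X}^n\times\mathcal{Y}^m$). For $r>0$, $\mathcal{N}_{\infty,1}(\mathcal{M},r)$ is the minimum number of balls of radius $r$ (closed, centered in $\mathcal{M}$) in this distance that cover $\mathcal{M}$ (it is $+\infty$ if no finite cover exists, in which case no $L$ satisfies the hypothesis). *)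

theory Defs
  imports "HOL-Probability.Probability"
begin

text \<open>
  Bidders are the elements of a finite type \<open>'n\<close>, items those of a finite type \<open>'m\<close>; \<open>'dx\<close> and
  \<open>'dy\<close> index the coordinates of bidder and item contexts.  Rules are functions on the full types,
  but every condition below only looks at their values for bids and contexts in the given sets.
\<close>

type_synonym ('n, 'm, 'dx, 'dy) datum =
  "((real, 'm) vec, 'n) vec \<times> ((real, 'dx) vec, 'n) vec \<times> ((real, 'dy) vec, 'm) vec"

type_synonym ('n, 'm, 'dx, 'dy) allocation =
  "((real, 'm) vec, 'n) vec \<Rightarrow> ((real, 'dx) vec, 'n) vec \<Rightarrow> ((real, 'dy) vec, 'm) vec
    \<Rightarrow> ((real, 'm) vec, 'n) vec"

type_synonym ('n, 'm, 'dx, 'dy) payment =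
  "((real, 'm) vec, 'n) vec \<Rightarrow> ((real, 'dx) vec, 'n) vec \<Rightarrow> ((real, 'dy) vec, 'm) vec
    \<Rightarrow> (real, 'n) vec"

type_synonym ('n, 'm, 'dx, 'dy) mechanism =
  "('n, 'm, 'dx, 'dy) allocation \<times> ('n, 'm, 'dx, 'dy) payment"

definition profiles :: "('i::finite \<Rightarrow> 'a set) \<Rightarrow> ('a ^ 'i) set" where
  "profiles A = {a. \<forall>i. a $ i \<in> A i}"

definition auction_domain ::
  "('n::finite \<Rightarrow> (real ^ 'm::finite) set) \<Rightarrow> (real ^ 'dx::finite) set \<Rightarrow> (real ^ 'dy::finite) set
    \<Rightarrow> ('n, 'm, 'dx, 'dy) datum set" where
  "auction_domain V X Y = profiles V \<times> profiles (\<lambda>_. X) \<times> profiles (\<lambda>_. Y)"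

definition replace_bid :: "'a ^ 'n \<Rightarrow> 'n::finite \<Rightarrow> 'a \<Rightarrow> 'a ^ 'n" where
  "replace_bid b i c = (\<chi> k. if k = i then c else b $ k)"

definition bundle_value :: "real ^ 'm::finite \<Rightarrow> 'm set \<Rightarrow> real" where
  "bundle_value vi S = (\<Sum>j\<in>S. vi $ j)"

definition auction_mechanism ::
  "('n::finite \<Rightarrow> (real ^ 'm::finite) set) \<Rightarrow> (real ^ 'dx::finite) set \<Rightarrow> (real ^ 'dy::finite) set
    \<Rightarrow> ('n, 'm, 'dx, 'dy) allocation \<Rightarrow> ('n, 'm, 'dx, 'dy) payment \<Rightarrow> bool" where
  "auction_mechanism V X Y g p \<longleftrightarrow>
    (\<forall>(b, x, y) \<in> auction_domain V X Y.
      (\<forall>i j. 0 \<le> g b x y $ i $ j \<and> g b x y $ i $ j \<le> 1) \<and>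
      (\<forall>j. (\<Sum>i\<in>UNIV. g b x y $ i $ j) \<le> 1) \<and>
      (\<forall>i. 0 \<le> p b x y $ i))"

definition utility ::
  "('n::finite, 'm::finite, 'dx::finite, 'dy::finite) allocation \<Rightarrow> ('n, 'm, 'dx, 'dy) payment
    \<Rightarrow> 'n \<Rightarrow> real ^ 'm \<Rightarrow> real ^ 'm ^ 'n \<Rightarrow> real ^ 'dx ^ 'n \<Rightarrow> real ^ 'dy ^ 'm \<Rightarrow> real" where
  "utility g p i vi b x y = (\<Sum>j\<in>UNIV. g b x y $ i $ j * vi $ j) - p b x y $ i"

text \<open>
  The profile \<open>b\<close> only enters through its components other than \<open>i\<close>; since \<open>vi \<in> V i\<close>, quantifying
  over full profiles is the same as quantifying over profiles of the other bidders.
\<close>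

definition individually_rational ::
  "('n::finite \<Rightarrow> (real ^ 'm::finite) set) \<Rightarrow> (real ^ 'dx::finite) set \<Rightarrow> (real ^ 'dy::finite) set
    \<Rightarrow> ('n, 'm, 'dx, 'dy) allocation \<Rightarrow> ('n, 'm, 'dx, 'dy) payment \<Rightarrow> bool" where
  "individually_rational V X Y g p \<longleftrightarrow>
    (\<forall>i. \<forall>vi \<in> V i. \<forall>(b, x, y) \<in> auction_domain V X Y.
      0 \<le> utility g p i vi (replace_bid b i vi) x y)"

text \<open>
  The supremum is that of the reals; it is the true supremum for individually rational mechanisms
  and bundle values bounded by \<open>1\<close>, where the utilities in question are bounded above by \<open>1\<close>.
\<close>

definition regret ::
  "('n::finite \<Rightarrow> (real ^ 'm::finite) set)
    \<Rightarrow> ('n, 'm, 'dx::finite, 'dy::finite) allocation \<Rightarrow> ('n, 'm, 'dx, 'dy) payment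
    \<Rightarrow> 'n \<Rightarrow> ('n, 'm, 'dx, 'dy) datum \<Rightarrow> real" where
  "regret V g p i = (\<lambda>(v, x, y).
    (SUP bi\<in>V i. utility g p i (v $ i) (replace_bid v i bi) x y) - utility g p i (v $ i) v x y)"

definition mechanism_dist ::
  "('n::finite \<Rightarrow> (real ^ 'm::finite) set) \<Rightarrow> (real ^ 'dx::finite) set \<Rightarrow> (real ^ 'dy::finite) set
    \<Rightarrow> ('n, 'm, 'dx, 'dy) mechanism \<Rightarrow> ('n, 'm, 'dx, 'dy) mechanism \<Rightarrow> ennreal" where
  "mechanism_dist V X Y = (\<lambda>(g, p) (g', p').
    SUP (v, x, y) \<in> auction_domain V X Y.
      ennreal ((\<Sum>i\<in>UNIV. \<Sum>j\<in>UNIV. \<bar>g v x y $ i $ j - g' v x y $ i $ j\<bar>)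
             + (\<Sum>i\<in>UNIV. \<bar>p v x y $ i - p' v x y $ i\<bar>)))"

text \<open>The infimum of the empty set in \<^typ>\<open>enat\<close> is \<open>\<infinity>\<close>: there is no finite cover.\<close>

definition covering_number ::
  "('n::finite \<Rightarrow> (real ^ 'm::finite) set) \<Rightarrow> (real ^ 'dx::finite) set \<Rightarrow> (real ^ 'dy::finite) set
    \<Rightarrow> ('n, 'm, 'dx, 'dy) mechanism set \<Rightarrow> real \<Rightarrow> enat" where
  "covering_number V X Y M r =
    (INF C \<in> {C. finite C \<and> C \<subseteq> M \<and>
                 (\<forall>a\<in>M. \<exists>c\<in>C. mechanism_dist V X Y c a \<le> ennreal r)}. enat (card C))"

definition payment_gap ::
  "('n::finite, 'm::finite, 'dx::finite, 'dy::finite) datum measure \<Rightarrow> nat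
    \<Rightarrow> ('n, 'm, 'dx, 'dy) payment \<Rightarrow> (nat \<Rightarrow> ('n, 'm, 'dx, 'dy) datum) \<Rightarrow> real" where
  "payment_gap D L p s =
    \<bar>\<Sum>i\<in>UNIV. (\<integral>(v, x, y). p v x y $ i \<partial>D)
        - (1 / real L) * (\<Sum>l<L. case s l of (v, x, y) \<Rightarrow> p v x y $ i)\<bar>"

definition empirical_regret ::
  "('n::finite \<Rightarrow> (real ^ 'm::finite) set) \<Rightarrow> nat
    \<Rightarrow> ('n, 'm, 'dx::finite, 'dy::finite) allocation \<Rightarrow> ('n, 'm, 'dx, 'dy) payment
    \<Rightarrow> (nat \<Rightarrow> ('n, 'm, 'dx, 'dy) datum) \<Rightarrow> 'n \<Rightarrow> real" where
  "empirical_regret V L g p s i = (1 / real L) * (\<Sum>l<L. regret V g p i (s l))"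

definition regret_gap ::
  "('n::finite \<Rightarrow> (real ^ 'm::finite) set) \<Rightarrow> ('n, 'm, 'dx::finite, 'dy::finite) datum measure \<Rightarrow> nat
    \<Rightarrow> ('n, 'm, 'dx, 'dy) allocation \<Rightarrow> ('n, 'm, 'dx, 'dy) payment
    \<Rightarrow> (nat \<Rightarrow> ('n, 'm, 'dx, 'dy) datum) \<Rightarrow> real" where
  "regret_gap V D L g p s =
    \<bar>(\<integral>z. (\<Sum>i\<in>UNIV. regret V g p i z) \<partial>D) - (\<Sum>i\<in>UNIV. empirical_regret V L g p s i)\<bar>"

text \<open>The law of \<open>L\<close> independent samples from \<open>D\<close>.\<close>

abbreviation sample_law :: "'a measure \<Rightarrow> nat \<Rightarrow> (nat \<Rightarrow> 'a) measure" where
  "sample_law D L \<equiv> PiM {..<L} (\<lambda>_. D)"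

end

(*
  Individual rationality bounds every payment and every regret by 1, so for one mechanism the
  total payment and the total regret are bounded by n and Hoeffding's inequality controls their
  empirical averages.  For nonnegative values, mechanisms at distance at most r have total payments
  within r and total regrets within 2 n r of each other.  With r = \<epsilon> / (6 n), a deviation of at most
  \<epsilon> / 3 on a finite cover therefore gives a deviation of at most \<epsilon> / 3 + 2 (2 n r) = \<epsilon> on the whole class.
*)
theory Submission
  imports Defs
begin

section \<open>Deviation of empirical means\<close>

text \<open>Common form of both gaps, so that payments and regrets pass through the same
  concentration and approximation lemmas.\<close>

definition mean_deviation :: "'a measure \<Rightarrow> nat \<Rightarrow> ('a \<Rightarrow> real) \<Rightarrow> (nat \<Rightarrow> 'a) \<Rightarrow> real" where
  "mean_deviation D L F s = \<bar>(\<integral>z. F z \<partial>D) - (\<Sum>l<L. F (s l)) / real L\<bar>"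

text \<open>Independence means that the joint law of the coordinates is the product of their laws.
  Here the joint map is restriction to \<open>I\<close>, which is the identity because the points of
  the product space are already extensional.\<close>

lemma indep_vars_PiM_components:
  assumes "\<And>i. i \<in> I \<Longrightarrow> prob_space (M i)" and "I \<noteq> {}"
  shows "prob_space.indep_vars (PiM I M) M (\<lambda>i \<omega>. \<omega> i) I"
proof -
  interpret P: prob_space "PiM I M"
    by (intro prob_space_PiM assms)
  have "distr (PiM I M) (PiM I M) (\<lambda>\<omega>. \<lambda>i\<in>I. \<omega> i) = distr (PiM I M) (PiM I M) (\<lambda>\<omega>. \<omega>)"
    by (intro distr_cong) (auto simp: space_PiM)
  also have "\<dots> = PiM I M"
    by simp
  also have "\<dots> = (\<Pi>\<^sub>M i\<in>I. distr (PiM I M) (M i) (\<lambda>\<omega>. \<omega> i))"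
    using assms by (intro PiM_cong refl sym[OF distr_PiM_component]) auto
  finally show ?thesis
    using assms(2) by (intro P.indep_vars_iff_distr_eq_PiM'[THEN iffD2]) auto
qed

text \<open>For sums of \<open>L\<close> independent variables with values in [0, c], Hoeffding's
  exponent at threshold L t is -2 (L t)^2 / (L c^2), where one factor L cancels.\<close>

lemma sample_law_Hoeffding:
  fixes F :: "'a \<Rightarrow> real"
  assumes "prob_space D" and F [measurable]: "F \<in> borel_measurable D"
    and bnd: "\<And>z. z \<in> space D \<Longrightarrow> 0 \<le> F z \<and> F z \<le> c"
    and "0 < c" "0 < L" "0 \<le> t"
  shows "measure (sample_law D L) {s \<in> space (sample_law D L). mean_deviation D L F s \<ge> t}
    \<le> 2 * exp (- 2 * real L * t\<^sup>2 / c\<^sup>2)"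
proof -
  interpret D: prob_space D by fact
  interpret P: prob_space "sample_law D L"
    by (intro prob_space_PiM assms(1))
  have E: "(\<integral>s. F (s l) \<partial>sample_law D L) = (\<integral>z. F z \<partial>D)" if "l < L" for l
  proof -
    have "(\<integral>z. F z \<partial>D) = (\<integral>z. F z \<partial>distr (sample_law D L) D (\<lambda>s. s l))"
      using that by (subst distr_PiM_component) (auto intro: assms(1))
    also have "\<dots> = (\<integral>s. F (s l) \<partial>sample_law D L)"
      using that by (intro integral_distr) auto
    finally show ?thesis ..
  qed
  interpret H: Hoeffding_ineq "sample_law D L" "{..<L}" "\<lambda>l s. F (s l)" "\<lambda>_. 0" "\<lambda>_. c"
    "\<Sum>l<L. P.expectation (\<lambda>s. F (s l))"
  proof unfold_locales
    have "P.indep_vars (\<lambda>_. D) (\<lambda>l s. s l) {..<L}"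
      using assms by (intro indep_vars_PiM_components) auto
    thus "P.indep_vars (\<lambda>_. borel) (\<lambda>l s. F (s l)) {..<L}"
      by (rule P.indep_vars_compose2) auto
  next
    fix l assume "l \<in> {..<L}"
    thus "AE s in sample_law D L. F (s l) \<in> {0..c}"
      by (intro AE_I2) (auto simp: space_PiM intro!: bnd)
  qed auto
  \<comment> \<open>Hoeffding's inequality speaks of sums rather than means; multiplying by
    \<open>L\<close> turns the threshold \<open>t\<close> into \<open>L * t\<close>.\<close>
  have dev_iff: "mean_deviation D L F s \<ge> t \<longleftrightarrow>
    \<bar>(\<Sum>l<L. F (s l)) - (\<Sum>l<L. P.expectation (\<lambda>s. F (s l)))\<bar> \<ge> real L * t" for s
  proof -
    have "\<bar>(\<Sum>l<L. F (s l)) - (\<Sum>l<L. P.expectation (\<lambda>s. F (s l)))\<bar>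
        = \<bar>real L * ((\<integral>z. F z \<partial>D) - (\<Sum>l<L. F (s l)) / real L)\<bar>"
      using \<open>0 < L\<close> by (simp add: E right_diff_distrib abs_minus_commute)
    also have "\<dots> = real L * mean_deviation D L F s"
      by (simp add: abs_mult mean_deviation_def)
    finally show ?thesis
      using \<open>0 < L\<close> by simp
  qed
  have "P.prob {s \<in> space (sample_law D L).
      \<bar>(\<Sum>l<L. F (s l)) - (\<Sum>l<L. P.expectation (\<lambda>s. F (s l)))\<bar> \<ge> real L * t}
      \<le> 2 * exp (- 2 * (real L * t)\<^sup>2 / (\<Sum>l<L. (c - 0)\<^sup>2))"
    using assms by (intro H.Hoeffding_ineq_abs_ge) auto
  also have "- 2 * (real L * t)\<^sup>2 / (\<Sum>l<L. (c - 0)\<^sup>2) = - 2 * real L * t\<^sup>2 / c\<^sup>2"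
    using assms by (simp add: power2_eq_square)
  finally show ?thesis
    unfolding dev_iff .
qed

text \<open>A union bound over \<open>K\<close>; \<open>small\<close> says that the tails add up to
  at most \<delta>. Measurability of the good event is also exported, since it later serves as a
  witness.\<close>

lemma sample_law_Hoeffding_finite_family:
  fixes K :: "('a \<Rightarrow> real) set"
  assumes "prob_space D" and "finite K" and meas: "\<And>F. F \<in> K \<Longrightarrow> F \<in> borel_measurable D"
    and bnd: "\<And>F z. F \<in> K \<Longrightarrow> z \<in> space D \<Longrightarrow> 0 \<le> F z \<and> F z \<le> c"
    and "0 < c" "0 < L" "0 \<le> t"
    and small: "real (card K) * (2 * exp (- 2 * real L * t\<^sup>2 / c\<^sup>2)) \<le> \<delta>"
  defines "E \<equiv> {s \<in> space (sample_law D L). \<forall>F\<in>K. mean_deviation D L F s \<le> t}"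
  shows "E \<in> sets (sample_law D L)" and "1 - \<delta> \<le> measure (sample_law D L) E"
proof -
  interpret P: prob_space "sample_law D L"
    by (intro prob_space_PiM assms(1))
  have dev [measurable]: "mean_deviation D L F \<in> borel_measurable (sample_law D L)" if "F \<in> K" for F
  proof -
    note meas[OF that, measurable]
    show ?thesis unfolding mean_deviation_def by measurable
  qed
  show E [measurable]: "E \<in> sets (sample_law D L)"
    unfolding E_def using \<open>finite K\<close> by measurable
  \<comment> \<open>The bad events also contain the case of equality, hence may meet
    \<open>E\<close>; only the complement of \<open>E\<close> has to be covered.\<close>
  let ?B = "\<lambda>F. {s \<in> space (sample_law D L). mean_deviation D L F s \<ge> t}"
  have "P.prob (space (sample_law D L) - E) \<le> P.prob (\<Union>F\<in>K. ?B F)"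
    using \<open>finite K\<close> by (intro P.finite_measure_mono sets.finite_UN) (auto simp: E_def)
  also have "\<dots> \<le> (\<Sum>F\<in>K. P.prob (?B F))"
    using \<open>finite K\<close> by (intro measure_UNION_le) auto
  also have "\<dots> \<le> (\<Sum>F\<in>K. 2 * exp (- 2 * real L * t\<^sup>2 / c\<^sup>2))"
    using assms by (intro sum_mono sample_law_Hoeffding) auto
  also have "\<dots> \<le> \<delta>"
    using small by simp
  finally show "1 - \<delta> \<le> P.prob E"
    using P.prob_compl[OF E] by simp
qed

text \<open>The error \<eta> enters twice: once in the expectation and once in the empirical
  mean.\<close>

lemma mean_deviation_close:
  assumes "prob_space D" "integrable D F" "integrable D G" "0 < L" "s \<in> space (sample_law D L)"
    and close: "\<And>z. z \<in> space D \<Longrightarrow> \<bar>F z - G z\<bar> \<le> \<eta>"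
  shows "mean_deviation D L F s \<le> mean_deviation D L G s + 2 * \<eta>"
proof -
  interpret prob_space D by fact
  have "\<bar>(\<integral>z. F z \<partial>D) - (\<integral>z. G z \<partial>D)\<bar> = \<bar>\<integral>z. F z - G z \<partial>D\<bar>"
    using assms by simp
  also have "\<dots> \<le> (\<integral>z. \<bar>F z - G z\<bar> \<partial>D)"
    by (rule integral_abs_bound)
  also have "\<dots> \<le> \<eta>"
    using assms by (intro integral_le_const) auto
  finally have 1: "\<bar>(\<integral>z. F z \<partial>D) - (\<integral>z. G z \<partial>D)\<bar> \<le> \<eta>" .
  have "\<bar>(\<Sum>l<L. F (s l)) - (\<Sum>l<L. G (s l))\<bar> \<le> (\<Sum>l<L. \<bar>F (s l) - G (s l)\<bar>)"
    unfolding sum_subtractf[symmetric] by (rule sum_abs)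
  also have "\<dots> \<le> (\<Sum>l<L. \<eta>)"
    using assms(5) by (intro sum_mono close) (auto simp: space_PiM)
  finally have "\<bar>(\<Sum>l<L. F (s l)) - (\<Sum>l<L. G (s l))\<bar> / real L \<le> \<eta>"
    using \<open>0 < L\<close> by (simp add: field_simps)
  hence 2: "\<bar>(\<Sum>l<L. F (s l)) / real L - (\<Sum>l<L. G (s l)) / real L\<bar> \<le> \<eta>"
    by (simp add: abs_divide flip: diff_divide_distrib)
  show ?thesis
    unfolding mean_deviation_def using 1 2 by linarith
qed

section \<open>Payments and regrets\<close>

text \<open>Both gaps take the absolute value after summing over bidders, so one function per
  mechanism has to concentrate, with range [0, n], instead of n functions.\<close>

definition total_payment :: "('n::finite, 'm::finite, 'dx::finite, 'dy::finite) mechanism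
    \<Rightarrow> ('n, 'm, 'dx, 'dy) datum \<Rightarrow> real" where
  "total_payment a = (\<lambda>(v, x, y). \<Sum>i\<in>UNIV. snd a v x y $ i)"

definition total_regret :: "('n::finite \<Rightarrow> (real ^ 'm::finite) set)
    \<Rightarrow> ('n, 'm, 'dx::finite, 'dy::finite) mechanism \<Rightarrow> ('n, 'm, 'dx, 'dy) datum \<Rightarrow> real" where
  "total_regret V a z = (\<Sum>i\<in>UNIV. regret V (fst a) (snd a) i z)"

text \<open>The payment gap sums expectations over bidders; integrability of each payment lets the
  sum move under the integral. Any \<open>g\<close> fits, as the total payment reads only the second
  component.\<close>

lemma payment_gap_eq_mean_deviation:
  assumes "\<And>i. integrable D (\<lambda>(v, x, y). p v x y $ i)"
  shows "payment_gap D L p = mean_deviation D L (total_payment (g, p))"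
proof
  fix s
  have "(\<integral>z. total_payment (g, p) z \<partial>D) = (\<integral>z. (\<Sum>i\<in>UNIV. case z of (v, x, y) \<Rightarrow> p v x y $ i) \<partial>D)"
    by (auto simp: total_payment_def intro!: Bochner_Integration.integral_cong)
  also have "\<dots> = (\<Sum>i\<in>UNIV. \<integral>(v, x, y). p v x y $ i \<partial>D)"
    using assms by (intro Bochner_Integration.integral_sum) auto
  finally have 1: "(\<Sum>i\<in>UNIV. \<integral>(v, x, y). p v x y $ i \<partial>D) = (\<integral>z. total_payment (g, p) z \<partial>D)" ..
  have "(\<Sum>i\<in>UNIV. (1 / real L) * (\<Sum>l<L. case s l of (v, x, y) \<Rightarrow> p v x y $ i))
      = (1 / real L) * (\<Sum>l<L. \<Sum>i\<in>UNIV. case s l of (v, x, y) \<Rightarrow> p v x y $ i)"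
    unfolding sum_distrib_left[symmetric] by (subst sum.swap) simp
  also have "\<dots> = (\<Sum>l<L. total_payment (g, p) (s l)) / real L"
    by (auto simp: total_payment_def split: prod.split intro!: arg_cong2[where f = "(/)"] sum.cong)
  finally show "payment_gap D L p s = mean_deviation D L (total_payment (g, p)) s"
    by (simp only: payment_gap_def mean_deviation_def sum_subtractf 1)
qed

text \<open>The expectation is already that of the sum over bidders, so only finite empirical sums
  are exchanged.\<close>

lemma regret_gap_eq_mean_deviation:
  "regret_gap V D L g p = mean_deviation D L (total_regret V (g, p))"
proof
  fix s
  have "(\<Sum>i\<in>UNIV. empirical_regret V L g p s i) = (\<Sum>l<L. total_regret V (g, p) (s l)) / real L"
    unfolding empirical_regret_def total_regret_def sum_distrib_left[symmetric]
    by (subst sum.swap) simp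
  thus "regret_gap V D L g p s = mean_deviation D L (total_regret V (g, p)) s"
    by (simp add: regret_gap_def mean_deviation_def total_regret_def)
qed

section \<open>Bids and the bounds given by individual rationality\<close>

lemma replace_bid_self [simp]: "replace_bid b i (b $ i) = b"
  by (simp add: replace_bid_def vec_eq_iff)

lemma replace_bid_in_domain:
  assumes "(v, x, y) \<in> auction_domain V X Y" "b \<in> V i"
  shows "(replace_bid v i b, x, y) \<in> auction_domain V X Y"
  using assms by (auto simp: auction_domain_def profiles_def replace_bid_def)

lemma auction_domain_bid: "(v, x, y) \<in> auction_domain V X Y \<Longrightarrow> v $ i \<in> V i"
  by (auto simp: auction_domain_def profiles_def)

text \<open>Item values may be negative: such items contribute at most 0, and the others at most
  their full value, so the bundle of items with nonnegative value dominates every fractional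
  allocation.\<close>

lemma fractional_value_le_1:
  fixes q w :: "real ^ 'm::finite"
  assumes "\<And>S. bundle_value w S \<le> 1" and "\<And>j. 0 \<le> q $ j \<and> q $ j \<le> 1"
  shows "(\<Sum>j\<in>UNIV. q $ j * w $ j) \<le> 1"
proof -
  have "(\<Sum>j\<in>UNIV. q $ j * w $ j) \<le> (\<Sum>j\<in>UNIV. if j \<in> {j. 0 \<le> w $ j} then w $ j else 0)"
  proof (intro sum_mono)
    fix j
    show "q $ j * w $ j \<le> (if j \<in> {j. 0 \<le> w $ j} then w $ j else 0)"
      using assms(2)[of j] by (auto simp: mult_left_le_one_le mult_nonneg_nonpos)
  qed
  also have "\<dots> = bundle_value w {j. 0 \<le> w $ j}"
    by (simp add: bundle_value_def flip: sum.inter_filter)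
  finally show ?thesis
    using assms(1)[of "{j. 0 \<le> w $ j}"] by linarith
qed

context
  fixes V :: "'n::finite \<Rightarrow> (real ^ 'm::finite) set"
    and X :: "(real ^ 'dx::finite) set" and Y :: "(real ^ 'dy::finite) set"
  assumes bundle_le_1: "\<forall>i. \<forall>vi \<in> V i. \<forall>S. bundle_value vi S \<le> 1"
begin

text \<open>Keeping the payment on the right lets a nonnegative utility bound it by 1. The bid of
  \<open>i\<close> in \<open>b\<close> may differ from \<open>vi\<close>, which covers
  misreports.\<close>

lemma utility_le_1_minus_payment:
  assumes "auction_mechanism V X Y g p" "(b, x, y) \<in> auction_domain V X Y" "vi \<in> V i"
  shows "utility g p i vi b x y \<le> 1 - p b x y $ i"
proof -
  have "(\<Sum>j\<in>UNIV. g b x y $ i $ j * vi $ j) \<le> 1"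
    using assms by (intro fractional_value_le_1) (auto simp: auction_mechanism_def bundle_le_1)
  thus ?thesis
    by (simp add: utility_def)
qed

lemma utility_le_1:
  assumes "auction_mechanism V X Y g p" "(b, x, y) \<in> auction_domain V X Y" "vi \<in> V i"
  shows "utility g p i vi b x y \<le> 1"
proof -
  have "0 \<le> p b x y $ i"
    using assms by (auto simp: auction_mechanism_def)
  thus ?thesis
    using utility_le_1_minus_payment[OF assms] by simp
qed

lemma truthful_utility_nonneg:
  assumes "individually_rational V X Y g p" "(v, x, y) \<in> auction_domain V X Y"
  shows "0 \<le> utility g p i (v $ i) v x y"
proof -
  have "0 \<le> utility g p i (v $ i) (replace_bid v i (v $ i)) x y"
    using assms auction_domain_bid[OF assms(2)] unfolding individually_rational_def by fast
  thus ?thesis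
    by simp
qed

text \<open>Truthful bidding gives 0 \<le> utility \<le> 1 - payment.\<close>

lemma payment_bounds:
  assumes "auction_mechanism V X Y g p" "individually_rational V X Y g p"
    and "(v, x, y) \<in> auction_domain V X Y"
  shows "0 \<le> p v x y $ i \<and> p v x y $ i \<le> 1"
  using assms truthful_utility_nonneg[OF assms(2,3), of i]
    utility_le_1_minus_payment[OF assms(1,3) auction_domain_bid[OF assms(3)], of i]
  by (auto simp: auction_mechanism_def)

text \<open>Makes the real supremum in the regret a true least upper bound.\<close>

lemma bdd_above_utility:
  assumes "auction_mechanism V X Y g p" "(v, x, y) \<in> auction_domain V X Y"
  shows "bdd_above ((\<lambda>b. utility g p i (v $ i) (replace_bid v i b) x y) ` V i)"
  using assms
  by (intro bdd_aboveI2[where M = 1] utility_le_1 replace_bid_in_domain)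
     (auto dest: auction_domain_bid)

text \<open>The truthful report competes in the supremum, so the regret is nonnegative; the best
  utility is at most 1 and the truthful one at least 0, so it is at most 1.\<close>

lemma regret_bounds:
  assumes "auction_mechanism V X Y g p" "individually_rational V X Y g p"
    and z: "z \<in> auction_domain V X Y"
  shows "0 \<le> regret V g p i z \<and> regret V g p i z \<le> 1"
proof -
  obtain v x y where zz: "z = (v, x, y)" by (cases z) auto
  have d: "(v, x, y) \<in> auction_domain V X Y" using z zz by simp
  have vi: "v $ i \<in> V i" by (rule auction_domain_bid[OF d])
  let ?u = "\<lambda>b. utility g p i (v $ i) (replace_bid v i b) x y"
  have "?u (v $ i) \<le> (SUP b\<in>V i. ?u b)"
    by (rule cSUP_upper[OF vi bdd_above_utility[OF assms(1) d]])
  moreover have "(SUP b\<in>V i. ?u b) \<le> 1"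
    using vi by (intro cSUP_least utility_le_1[OF assms(1)] replace_bid_in_domain[OF d]) auto
  ultimately show ?thesis
    using truthful_utility_nonneg[OF assms(2) d, of i] by (simp add: regret_def zz)
qed

lemma total_payment_bounds:
  assumes "auction_mechanism V X Y g p" "individually_rational V X Y g p"
    and "z \<in> auction_domain V X Y"
  shows "0 \<le> total_payment (g, p) z \<and> total_payment (g, p) z \<le> real CARD('n)"
proof (cases z)
  case (fields v x y)
  have b: "0 \<le> p v x y $ i \<and> p v x y $ i \<le> 1" for i
    using payment_bounds[OF assms(1,2)] assms(3) fields by blast
  have "(\<Sum>i\<in>UNIV. p v x y $ i) \<le> real CARD('n) * 1"
    using b by (intro sum_bounded_above) auto
  with b show ?thesis
    by (auto simp: fields total_payment_def intro: sum_nonneg)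
qed

lemma total_regret_bounds:
  assumes "auction_mechanism V X Y g p" "individually_rational V X Y g p"
    and "z \<in> auction_domain V X Y"
  shows "0 \<le> total_regret V (g, p) z \<and> total_regret V (g, p) z \<le> real CARD('n)"
proof -
  note b = regret_bounds[OF assms]
  have "(\<Sum>i\<in>UNIV. regret V g p i z) \<le> real CARD('n) * 1"
    using b by (intro sum_bounded_above) auto
  with b show ?thesis
    by (auto simp: total_regret_def intro: sum_nonneg)
qed

section \<open>Dependence of payments and regrets on the mechanism\<close>

lemma mechanism_dist_le:
  assumes "mechanism_dist V X Y (g, p) (g', p') \<le> ennreal r" "0 \<le> r"
    and "(v, x, y) \<in> auction_domain V X Y"
  shows "(\<Sum>i\<in>UNIV. \<Sum>j\<in>UNIV. \<bar>g v x y $ i $ j - g' v x y $ i $ j\<bar>)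
    + (\<Sum>i\<in>UNIV. \<bar>p v x y $ i - p' v x y $ i\<bar>) \<le> r"
proof -
  let ?d = "\<lambda>(v, x, y). ennreal ((\<Sum>i\<in>UNIV. \<Sum>j\<in>UNIV. \<bar>g v x y $ i $ j - g' v x y $ i $ j\<bar>)
             + (\<Sum>i\<in>UNIV. \<bar>p v x y $ i - p' v x y $ i\<bar>))"
  have "?d (v, x, y) \<le> (SUP z\<in>auction_domain V X Y. ?d z)"
    by (rule SUP_upper) fact
  also have "\<dots> \<le> ennreal r"
    using assms(1) by (simp add: mechanism_dist_def)
  finally show ?thesis
    using assms(2) by (simp add: ennreal_le_iff)
qed

text \<open>The distance already sums the payment differences over all bidders, hence no factor
  n.\<close>

lemma total_payment_close:
  assumes "mechanism_dist V X Y (g, p) (g', p') \<le> ennreal r" "0 \<le> r" "z \<in> auction_domain V X Y"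
  shows "\<bar>total_payment (g', p') z - total_payment (g, p) z\<bar> \<le> r"
proof (cases z)
  case (fields v x y)
  have "\<bar>\<Sum>i\<in>UNIV. p' v x y $ i - p v x y $ i\<bar> \<le> (\<Sum>i\<in>UNIV. \<bar>p v x y $ i - p' v x y $ i\<bar>)"
    by (rule order_trans[OF sum_abs]) (simp add: abs_minus_commute)
  also have "\<dots> \<le> (\<Sum>i\<in>UNIV. \<Sum>j\<in>UNIV. \<bar>g v x y $ i $ j - g' v x y $ i $ j\<bar>)
      + (\<Sum>i\<in>UNIV. \<bar>p v x y $ i - p' v x y $ i\<bar>)"
    by (simp add: sum_nonneg)
  also have "\<dots> \<le> r"
    using mechanism_dist_le[OF assms(1,2)] assms(3) fields by blast
  finally show ?thesis
    by (simp add: fields total_payment_def sum_subtractf)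
qed

text \<open>Singleton bundles give \<open>vi $ j\<close> \<le> 1, and nonnegativity supplies the
  lower bound, so weighting by values does not enlarge allocation differences. Row \<open>i\<close>
  and payment \<open>i\<close> are then part of the full distance.\<close>

lemma utility_close:
  assumes "mechanism_dist V X Y (g, p) (g', p') \<le> ennreal r" "0 \<le> r"
    and "(b, x, y) \<in> auction_domain V X Y" "vi \<in> V i" "\<And>j. 0 \<le> vi $ j"
  shows "\<bar>utility g' p' i vi b x y - utility g p i vi b x y\<bar> \<le> r"
proof -
  have v1: "vi $ j \<le> 1" for j
    using bundle_le_1[rule_format, OF assms(4), of "{j}"] by (simp add: bundle_value_def)
  let ?G = "\<lambda>i j. \<bar>g b x y $ i $ j - g' b x y $ i $ j\<bar>"
  have "\<bar>\<Sum>j\<in>UNIV. (g' b x y $ i $ j - g b x y $ i $ j) * vi $ j\<bar>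
      \<le> (\<Sum>j\<in>UNIV. \<bar>(g' b x y $ i $ j - g b x y $ i $ j) * vi $ j\<bar>)"
    by (rule sum_abs)
  also have "\<dots> \<le> (\<Sum>j\<in>UNIV. ?G i j)"
    using assms(5) v1 by (intro sum_mono) (simp add: abs_mult abs_minus_commute mult_left_le)
  also have "\<dots> \<le> (\<Sum>i\<in>UNIV. \<Sum>j\<in>UNIV. ?G i j)"
    by (rule member_le_sum) (auto simp: sum_nonneg)
  finally have 1: "\<bar>\<Sum>j\<in>UNIV. (g' b x y $ i $ j - g b x y $ i $ j) * vi $ j\<bar>
      \<le> (\<Sum>i\<in>UNIV. \<Sum>j\<in>UNIV. ?G i j)" .
  have 2: "\<bar>p b x y $ i - p' b x y $ i\<bar> \<le> (\<Sum>i\<in>UNIV. \<bar>p b x y $ i - p' b x y $ i\<bar>)"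
    by (rule member_le_sum) auto
  have "utility g' p' i vi b x y - utility g p i vi b x y
      = (\<Sum>j\<in>UNIV. (g' b x y $ i $ j - g b x y $ i $ j) * vi $ j) + (p b x y $ i - p' b x y $ i)"
    by (simp add: utility_def left_diff_distrib sum_subtractf)
  thus ?thesis
    using 1 2 mechanism_dist_le[OF assms(1-3)] by linarith
qed

text \<open>One r for the supremum over misreports and one r for the truthful utility.\<close>

lemma regret_close:
  assumes "auction_mechanism V X Y g p" "auction_mechanism V X Y g' p'"
    and dist: "mechanism_dist V X Y (g, p) (g', p') \<le> ennreal r" "0 \<le> r"
    and z: "z \<in> auction_domain V X Y" and nonneg: "\<And>vi j. vi \<in> V i \<Longrightarrow> 0 \<le> vi $ j"
  shows "\<bar>regret V g' p' i z - regret V g p i z\<bar> \<le> 2 * r"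
proof -
  obtain v x y where zz: "z = (v, x, y)" by (cases z) auto
  have d: "(v, x, y) \<in> auction_domain V X Y" using z zz by simp
  have vi: "v $ i \<in> V i" by (rule auction_domain_bid[OF d])
  let ?u = "\<lambda>b. utility g p i (v $ i) (replace_bid v i b) x y"
  let ?u' = "\<lambda>b. utility g' p' i (v $ i) (replace_bid v i b) x y"
  have close: "\<bar>?u' b - ?u b\<bar> \<le> r" if "b \<in> V i" for b
    by (rule utility_close[OF dist replace_bid_in_domain[OF d that] vi nonneg[OF vi]])
  have up: "?u b \<le> (SUP b\<in>V i. ?u b)" "?u' b \<le> (SUP b\<in>V i. ?u' b)" if "b \<in> V i" for b
    using bdd_above_utility[OF assms(1) d] bdd_above_utility[OF assms(2) d] that
    by (auto intro: cSUP_upper)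
  \<comment> \<open>Every \<open>?u' b\<close> is at most \<open>?u b + r\<close>, hence at most the
    other supremum plus \<open>r\<close>; \<open>vi\<close> shows that \<open>V i\<close> is
    nonempty.\<close>
  have "(SUP b\<in>V i. ?u' b) \<le> (SUP b\<in>V i. ?u b) + r"
    using vi close up(1) by (intro cSUP_least) (auto simp: abs_le_iff, smt (verit))
  moreover have "(SUP b\<in>V i. ?u b) \<le> (SUP b\<in>V i. ?u' b) + r"
    using vi close up(2) by (intro cSUP_least) (auto simp: abs_le_iff, smt (verit))
  moreover have "\<bar>utility g' p' i (v $ i) v x y - utility g p i (v $ i) v x y\<bar> \<le> r"
    using close[OF vi] by simp
  ultimately show ?thesis
    by (simp add: regret_def zz)
qed

text \<open>Misreports take each bidder's regret to different bid profiles, so the distance is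
  applied bidder by bidder, which costs the factor n.\<close>

lemma total_regret_close:
  assumes "auction_mechanism V X Y g p" "auction_mechanism V X Y g' p'"
    and "mechanism_dist V X Y (g, p) (g', p') \<le> ennreal r" "0 \<le> r"
    and "z \<in> auction_domain V X Y" and "\<And>i vi j. vi \<in> V i \<Longrightarrow> 0 \<le> vi $ j"
  shows "\<bar>total_regret V (g', p') z - total_regret V (g, p) z\<bar> \<le> real CARD('n) * (2 * r)"
proof -
  have "\<bar>\<Sum>i\<in>UNIV. regret V g' p' i z - regret V g p i z\<bar>
      \<le> (\<Sum>i\<in>UNIV. \<bar>regret V g' p' i z - regret V g p i z\<bar>)"
    by (rule sum_abs)
  also have "\<dots> \<le> real CARD('n) * (2 * r)"
    using assms by (intro sum_bounded_above regret_close) auto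
  finally show ?thesis
    by (simp add: total_regret_def sum_subtractf)
qed

end

section \<open>The sample complexity bound\<close>

text \<open>A finite value excludes the empty infimum, and a nonempty set in a well-order contains
  its infimum.\<close>

lemma covering_number_attained:
  assumes "covering_number V X Y M r \<noteq> \<infinity>"
  obtains C where "finite C" "C \<subseteq> M" "\<And>a. a \<in> M \<Longrightarrow> \<exists>c\<in>C. mechanism_dist V X Y c a \<le> ennreal r"
    "card C = the_enat (covering_number V X Y M r)"
proof -
  let ?S = "{C. finite C \<and> C \<subseteq> M \<and> (\<forall>a\<in>M. \<exists>c\<in>C. mechanism_dist V X Y c a \<le> ennreal r)}"
  let ?E = "(\<lambda>C. enat (card C)) ` ?S"
  have "?E \<noteq> {}"
  proof
    assume "?E = {}"
    hence "covering_number V X Y M r = \<infinity>"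
      unfolding covering_number_def by (simp only: Inf_empty top_enat_def)
    with assms show False by simp
  qed
  hence "Inf ?E \<in> ?E"
    by (auto simp only: ex_in_conv[symmetric] intro: wellorder_InfI)
  then obtain C where "C \<in> ?S" "covering_number V X Y M r = enat (card C)"
    unfolding covering_number_def by blast
  thus thesis
    using that by auto
qed

text \<open>A cover of size N gives 2 N functions, a payment and a regret for each centre, with
  two-sided tails: this is the 4 inside the logarithm. Accuracy \<epsilon> / 3 and range n give the
  factor 9 n^2 / (2 \<epsilon>^2).\<close>

lemma Hoeffding_sample_size:
  fixes n \<epsilon> \<delta> N :: real
  assumes "0 < n" "0 < \<epsilon>" "0 < \<delta>" "1 \<le> N"
    and "real L \<ge> 9 * n\<^sup>2 / (2 * \<epsilon>\<^sup>2) * (ln (4 / \<delta>) + ln N)"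
  shows "2 * N * (2 * exp (- 2 * real L * (\<epsilon> / 3)\<^sup>2 / n\<^sup>2)) \<le> \<delta>"
proof -
  have "ln (4 / \<delta>) + ln N \<le> 2 * real L * (\<epsilon> / 3)\<^sup>2 / n\<^sup>2"
    using assms by (simp add: field_simps)
  hence "exp (- 2 * real L * (\<epsilon> / 3)\<^sup>2 / n\<^sup>2) \<le> exp (- (ln (4 / \<delta>) + ln N))"
    by simp
  also have "\<dots> = \<delta> / (4 * N)"
    using assms by (simp add: exp_minus exp_add exp_diff field_simps)
  finally show ?thesis
    using assms by (simp add: field_simps)
qed

text \<open>The first conjunct fixes the mechanism and allows values of either sign. The second is
  uniform over the class; it asserts a measurable event inside the set of good samples, since that
  set is an intersection over a possibly uncountable class and may fail to be measurable.\<close>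

theorem theorem2p6:
  fixes V :: "'n::finite \<Rightarrow> (real ^ 'm::finite) set"
    and X :: "(real ^ 'dx::finite) set" and Y :: "(real ^ 'dy::finite) set"
    and D :: "('n, 'm, 'dx, 'dy) datum measure"
    and M :: "('n, 'm, 'dx, 'dy) mechanism set"
    and \<delta> \<epsilon> :: real and L :: nat
  assumes "prob_space D"
    and "sets D = sets (restrict_space borel (auction_domain V X Y))"
    and "\<And>g p. (g, p) \<in> M \<Longrightarrow> auction_mechanism V X Y g p"
    and "\<And>g p. (g, p) \<in> M \<Longrightarrow> individually_rational V X Y g p"
    and "\<And>g p i. (g, p) \<in> M \<Longrightarrow> (\<lambda>(v, x, y). p v x y $ i) \<in> borel_measurable D"
    and "\<And>g p i. (g, p) \<in> M \<Longrightarrow> regret V g p i \<in> borel_measurable D"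
    and "\<And>i vi S. vi \<in> V i \<Longrightarrow> bundle_value vi S \<le> 1"
    and "0 < \<delta>" "\<delta> < 1" "0 < \<epsilon>" "\<epsilon> < 1"
    and "covering_number V X Y M (\<epsilon> / (6 * real CARD('n))) \<noteq> \<infinity>"
    and "real L \<ge> 9 * (real CARD('n))\<^sup>2 / (2 * \<epsilon>\<^sup>2) *
      (ln (4 / \<delta>) + ln (real (the_enat (covering_number V X Y M (\<epsilon> / (6 * real CARD('n)))))))"
  shows "(\<forall>(g, p) \<in> M.
            measure (sample_law D L)
              {s \<in> space (sample_law D L). payment_gap D L p s \<le> \<epsilon> \<and> regret_gap V D L g p s \<le> \<epsilon>}
            \<ge> 1 - \<delta>)
       \<and> ((\<forall>i. \<forall>vi \<in> V i. \<forall>j. 0 \<le> vi $ j) \<longrightarrow>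
          (\<exists>E \<in> sets (sample_law D L). measure (sample_law D L) E \<ge> 1 - \<delta> \<and>
            (\<forall>s \<in> E. \<forall>(g, p) \<in> M. payment_gap D L p s \<le> \<epsilon> \<and> regret_gap V D L g p s \<le> \<epsilon>)))"
proof -
  let ?n = "real CARD('n)"
  let ?r = "\<epsilon> / (6 * ?n)"
  let ?P = "sample_law D L"
  interpret D: prob_space D by fact
  interpret P: prob_space ?P by (intro prob_space_PiM assms(1))
  have le1: "\<forall>i. \<forall>vi \<in> V i. \<forall>S. bundle_value vi S \<le> 1"
    using assms(7) by blast
  have n: "0 < ?n" and n1: "1 \<le> ?n"
    by (simp_all add: Suc_le_eq)
  have space_D: "space D = auction_domain V X Y"
    using sets_eq_imp_space_eq[OF assms(2)] by (simp add: space_restrict_space)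
  obtain C where C: "finite C" "C \<subseteq> M" "\<And>a. a \<in> M \<Longrightarrow> \<exists>c\<in>C. mechanism_dist V X Y c a \<le> ennreal ?r"
    "card C = the_enat (covering_number V X Y M ?r)"
    using covering_number_attained[OF assms(12)] by blast
  have meas: "total_payment a \<in> borel_measurable D" "total_regret V a \<in> borel_measurable D"
    if "a \<in> M" for a
  proof -
    obtain g p where a: "a = (g, p)" by (cases a)
    note [measurable] = assms(5,6)[OF that[unfolded a]]
    have eq: "total_payment a = (\<lambda>z. \<Sum>i\<in>UNIV. case z of (v, x, y) \<Rightarrow> p v x y $ i)"
      by (auto simp: a total_payment_def)
    show "total_payment a \<in> borel_measurable D"
      unfolding eq by measurable
    show "total_regret V a \<in> borel_measurable D"
      unfolding a total_regret_def[abs_def] fst_conv snd_conv by measurable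
  qed
  have bounds: "0 \<le> total_payment a z \<and> total_payment a z \<le> ?n"
    "0 \<le> total_regret V a z \<and> total_regret V a z \<le> ?n"
    if "a \<in> M" "z \<in> space D" for a z
    using that total_payment_bounds[OF le1 assms(3,4)] total_regret_bounds[OF le1 assms(3,4)]
    unfolding space_D by (cases a; simp)+
  have int: "integrable D (total_payment a)" "integrable D (total_regret V a)" if "a \<in> M" for a
    using that bounds[OF that] meas[OF that]
    by (auto intro!: D.integrable_const_bound[where B = ?n])
  have gap: "payment_gap D L p = mean_deviation D L (total_payment (g, p))" if "(g, p) \<in> M" for g p
  proof (rule payment_gap_eq_mean_deviation)
    fix i
    show "integrable D (\<lambda>(v, x, y). p v x y $ i)"
      using payment_bounds[OF le1 assms(3,4)[OF that]] assms(5)[OF that]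
      by (intro D.integrable_const_bound[where B = 1]) (auto simp: space_D)
  qed
  \<comment> \<open>Payments and regrets form one family, so a single union bound treats
    both.\<close>
  define F where "F A = total_payment ` A \<union> total_regret V ` A"
    for A :: "('n, 'm, 'dx, 'dy) mechanism set"
  have card_F: "card (F A) \<le> 2 * card A" if "finite A" for A
    unfolding F_def using card_Un_le[of "total_payment ` A" "total_regret V ` A"]
      card_image_le[OF that, of total_payment] card_image_le[OF that, of "total_regret V"] by linarith
  \<comment> \<open>Used twice: with one mechanism and tolerance \<epsilon> for the first conjunct,
    with the cover \<open>C\<close> and tolerance \<epsilon> / 3 for the second.\<close>
  define G where "G A t = {s \<in> space ?P. \<forall>h\<in>F A. mean_deviation D L h s \<le> t}" for A t
  have G: "G A t \<in> sets ?P" "1 - \<delta> \<le> P.prob (G A t)" and L: "0 < L"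
    if "M \<noteq> {}" "finite A" "A \<subseteq> M" "card A \<le> card C" "\<epsilon> / 3 \<le> t" for A t
  proof -
    \<comment> \<open>A nonempty cover has ln (card C) \<ge> 0, so the hypothesis on
      \<open>L\<close> forces \<open>L\<close> to be positive.\<close>
    have "C \<noteq> {}"
      using C(3) \<open>M \<noteq> {}\<close> by blast
    hence C1: "1 \<le> real (card C)"
      using C(1) by (simp add: Suc_le_eq card_gt_0_iff)
    have size: "real L \<ge> 9 * ?n\<^sup>2 / (2 * \<epsilon>\<^sup>2) * (ln (4 / \<delta>) + ln (real (card C)))"
      using assms(13) by (simp only: C(4))
    have "0 < 9 * ?n\<^sup>2 / (2 * \<epsilon>\<^sup>2) * (ln (4 / \<delta>) + ln (real (card C)))"
      using assms C1 by (intro mult_pos_pos add_pos_nonneg) auto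
    with size show "0 < L" by simp
    \<comment> \<open>A larger tolerance only shrinks the tail, so the sample size for \<epsilon> /
      3 suffices for every such \<open>t\<close>.\<close>
    have "2 * real L * (\<epsilon> / 3)\<^sup>2 / ?n\<^sup>2 \<le> 2 * real L * t\<^sup>2 / ?n\<^sup>2"
      using that(5) assms(10) by (intro divide_right_mono mult_left_mono power_mono) auto
    hence "real (card (F A)) * (2 * exp (- 2 * real L * t\<^sup>2 / ?n\<^sup>2))
        \<le> 2 * real (card C) * (2 * exp (- 2 * real L * (\<epsilon> / 3)\<^sup>2 / ?n\<^sup>2))"
      using card_F[OF that(2)] that(4) by (intro mult_mono) auto
    also have "\<dots> \<le> \<delta>"
      using assms C1 size by (intro Hoeffding_sample_size) auto
    finally have *: "real (card (F A)) * (2 * exp (- 2 * real L * t\<^sup>2 / ?n\<^sup>2)) \<le> \<delta>" .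
    have F: "h \<in> borel_measurable D" "\<And>z. z \<in> space D \<Longrightarrow> 0 \<le> h z \<and> h z \<le> ?n" if "h \<in> F A" for h
      using that \<open>A \<subseteq> M\<close> meas bounds unfolding F_def by blast+
    have fin: "finite (F A)" and t: "0 \<le> t"
      using that assms(10) by (auto simp: F_def)
    show "G A t \<in> sets ?P" "1 - \<delta> \<le> P.prob (G A t)"
      unfolding G_def
      by (rule sample_law_Hoeffding_finite_family[OF assms(1) fin _ _ n \<open>0 < L\<close> t *];
          use F in blast)+
  qed
  have "1 - \<delta> \<le> P.prob {s \<in> space ?P. payment_gap D L p s \<le> \<epsilon> \<and> regret_gap V D L g p s \<le> \<epsilon>}"
    if gp: "(g, p) \<in> M" for g p
  proof -
    \<comment> \<open>A single mechanism is a family no larger than the nonempty cover, so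
      concentration applies to it directly, without approximation by centres.\<close>
    have "card {(g, p)} \<le> card C"
      using C(1,3) gp by (auto simp: Suc_le_eq card_gt_0_iff)
    hence "1 - \<delta> \<le> P.prob (G {(g, p)} \<epsilon>)"
      using gp assms(10) by (intro G) auto
    also have "G {(g, p)} \<epsilon> = {s \<in> space ?P. payment_gap D L p s \<le> \<epsilon> \<and> regret_gap V D L g p s \<le> \<epsilon>}"
      by (auto simp: G_def F_def gap[OF gp] regret_gap_eq_mean_deviation)
    finally show ?thesis .
  qed
  moreover have "\<exists>E \<in> sets ?P. P.prob E \<ge> 1 - \<delta> \<and>
      (\<forall>s \<in> E. \<forall>(g, p) \<in> M. payment_gap D L p s \<le> \<epsilon> \<and> regret_gap V D L g p s \<le> \<epsilon>)"
    if nonneg: "\<forall>i. \<forall>vi \<in> V i. \<forall>j. 0 \<le> vi $ j"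
  \<comment> \<open>\<open>G\<close> requires a nonempty class; for the empty one the claim is
    vacuous on the whole sample space.\<close>
  proof (cases "M = {}")
    case True
    thus ?thesis
      using assms(8) by (intro bexI[of _ "space ?P"]) (auto simp: P.prob_space)
  next
    case False
    note GC = G[OF False C(1,2) order_refl order_refl] L[OF False C(1,2) order_refl order_refl]
    have "payment_gap D L p s \<le> \<epsilon> \<and> regret_gap V D L g p s \<le> \<epsilon>"
      if s: "s \<in> G C (\<epsilon> / 3)" and gp: "(g, p) \<in> M" for s g p
    proof -
      obtain g' p' where c: "(g', p') \<in> C" "mechanism_dist V X Y (g', p') (g, p) \<le> ennreal ?r"
        using C(3)[OF gp] by auto
      have c': "(g', p') \<in> M"
        using c(1) C(2) by blast
      \<comment> \<open>The regret error 2 (n (2 r)) equals 2 \<epsilon> / 3 and fills the budget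
        left by \<epsilon> / 3; \<open>r2\<close> shows that the payment error 2 r is no
        larger.\<close>
      have r: "0 \<le> ?r" "?n * (4 * ?r) = 2 * \<epsilon> / 3"
        using assms(10) by (auto simp: field_simps)
      have r2: "2 * ?r \<le> ?n * (4 * ?r)"
        using mult_right_mono[OF n1, of "4 * ?r"] r(1) by linarith
      have s': "s \<in> space ?P"
        using s by (simp add: G_def)
      have "mean_deviation D L (total_payment (g, p)) s
          \<le> mean_deviation D L (total_payment (g', p')) s + 2 * ?r"
        using total_payment_close[OF le1 c(2) r(1)] unfolding space_D[symmetric]
        by (intro mean_deviation_close[OF assms(1) int(1)[OF gp] int(1)[OF c'] GC(3) s']) auto
      moreover have "mean_deviation D L (total_regret V (g, p)) s
          \<le> mean_deviation D L (total_regret V (g', p')) s + 2 * (?n * (2 * ?r))"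
        using total_regret_close[OF le1 assms(3)[OF c'] assms(3)[OF gp] c(2) r(1)] nonneg
        unfolding space_D[symmetric]
        by (intro mean_deviation_close[OF assms(1) int(2)[OF gp] int(2)[OF c'] GC(3) s']) auto
      moreover have "mean_deviation D L (total_payment (g', p')) s \<le> \<epsilon> / 3"
        "mean_deviation D L (total_regret V (g', p')) s \<le> \<epsilon> / 3"
        using s c(1) by (auto simp: G_def F_def)
      ultimately show ?thesis
        using r r2 unfolding gap[OF gp] regret_gap_eq_mean_deviation by linarith
    qed
    thus ?thesis
      using GC by (intro bexI[of _ "G C (\<epsilon> / 3)"]) auto
  qed
  ultimately show ?thesis
    by blast
qed

end
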